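(* Let $k\ge 1$ be an integer. If $G$ and $G'$ are $k$-equivalent graphs, then they are not distinguished by the interacting $k$-Boson quantum walk. That is, for every choice of energy penalties $U_1,\dots,U_\ell\in\mathbb{R}$ (the same for both graphs), with $H_{kB}$ and $H'_{kB}$ the corresponding $k$-Boson Hamiltonians of $G$ and $G'$, and for every $t\in\mathbb{R}$, the sets of Green's functions $$\{\langle y|e^{-itH_{kB}}|x\rangle: x,y\in V^k\}\quad\text{and}\quad\{\langle y|e^{-itH'_{kB}}|x\rangle: x,y\in V^k\}$$ are equal.
   Context: Graphs are finite, simple and undirected. Cellular algebras: for a finite set $V$, $\mathrm{Mat}_V$ is the algebra of complex matrices indexed by $V$. A cellular algebra on $V$ is a subalgebra $W\subseteq\mathrm{Mat}_V$ closed under Hadamard (entrywise) multiplication $\circ$ and under conjugate transpose $^\dagger$, and containing the identity $I$ and the all-ones matrix $J$. The smallest cellular algebra containing given matrices or sets of matrices is denoted $[\,\cdot\,]$. For a graph $G$ with adjacency matrix $A$, $[G]=[A]$. A weak isomorphism $W\to W'$ between cellular algebras is a linear bijection that preserves matrix multiplication, Hadamard multiplication and conjugate transpose. Extensions: for a group $\Gamma$ acting on a finite set $S$, $\mathcal{Z}(\Gamma,S)=\{A\in\mathrm{Mat}_S: A^g=A\ \forall g\in\Gamma\}$, where $A^g$ is $A$ with rows and columns permuted by $g$. $\mathrm{Sym}(V)$ acts entrywise on $V^k$. The $k$-extension of $W$ is $\widehat{W}^{(k)}=[W^k,\mathcal{Z}(\mathrm{Sym}(V),V^k)]\subseteq\mathrm{Mat}_{V^k}$,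 where $W^k$ is the $k$-fold tensor power of $W$. Equivalence: let $G,G'$ have adjacency matrices $A,A'$. An equivalence from $G$ to $G'$ is a weak isomorphism $\phi:[G]\to[G']$ with $\phi(A)=A'$. It is a $k$-equivalence if moreover there is a weak isomorphism $\widehat\phi:\widehat{[G]}^{(k)}\to\widehat{[G']}^{(k)}$ with $\widehat\phi|_{[G]^k}=\phi^k$ (the $k$-fold tensor power of $\phi$) and $\widehat\phi|_{\mathcal{Z}(\mathrm{Sym}(V),V^k)}$ the identity; here the vertex sets of $G$ and $G'$ have equal size and are identified with a common set $V$ by a bijection (the choice is immaterial). $G$ and $G'$ are $k$-equivalent if a $k$-equivalence from $G$ to $G'$ exists. $k$-Boson Hamiltonian: let $G$ be a graph on $V$ with adjacency matrix $A$. Operators act on the space with orthonormal basis $\{|x\rangle:x\in V^k\}$, i.e. they are matrices in $\mathrm{Mat}_{V^k}$. Each $S\in\mathrm{Sym}(k)$ is identified with the operator permuting the $k$ tensor factors. Put $A^{\oplus k}=A\otimes I\otimes\cdots\otimes I+\cdots+I\otimes\cdots\otimes I\otimes A$ ($k$ summands). For $x\in V^k$ and $v\in V$ let $v_x$ be the number of coordinates of $x$ equal to $v$, and let $V_x=\{v_x:v\in V\}$ as a multiset. Let $X_1,\dots,X_\ell$ be the classes of the equivalence relation on $V^k$ defined by $x\sim y\iff V_x=V_y$, let $R_i=\sum_{x\in X_i}|x\rangle\langle x|$, and assign to each $X_i$ a real energy penalty $U_i$. Then $$H_{kB}=-\frac{1}{k!}\Bigl(\sum_{S\in\mathrm{Sym}(k)}S\Bigr)A^{\oplus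 k}+\sum_{i=1}^{\ell}U_iR_i .$$ $H'_{kB}$ is defined in the same way from $G'$, with $A'$ in place of $A$. The Green's functions at time $t$ are the values $\langle y|e^{-itH}|x\rangle$, with $x,y$ running over the basis; two graphs are distinguished if their sets of Green's functions differ. *)

theory Defs
  imports "HOL-Analysis.Analysis"
begin

section \<open>Complex matrices and cellular algebras\<close>

type_synonym 'a cmatrix = "complex ^ 'a ^ 'a"

definition cscale :: "complex \<Rightarrow> 'a::finite cmatrix \<Rightarrow> 'a cmatrix"  (infixr \<open>*\<^sub>c\<close> 75)
  where "c *\<^sub>c A = (\<chi> i j. c * A $ i $ j)"

interpretation cmat: vector_space "cscale :: complex \<Rightarrow> 'a::finite cmatrix \<Rightarrow> 'a cmatrix"
  by standard (simp_all add: cscale_def vec_eq_iff algebra_simps)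

definition hadamard :: "'a::finite cmatrix \<Rightarrow> 'a cmatrix \<Rightarrow> 'a cmatrix"  (infixl \<open>\<odot>\<close> 70)
  where "A \<odot> B = (\<chi> i j. A $ i $ j * B $ i $ j)"

definition conj_transpose :: "'a::finite cmatrix \<Rightarrow> 'a cmatrix"
  where "conj_transpose A = (\<chi> i j. cnj (A $ j $ i))"

definition all_ones :: "'a::finite cmatrix"
  where "all_ones = (\<chi> i j. 1)"

definition cellular_algebra :: "'a::finite cmatrix set \<Rightarrow> bool"
  where "cellular_algebra W \<longleftrightarrow>
    cmat.subspace W \<and>
    (\<forall>A\<in>W. \<forall>B\<in>W. A ** B \<in> W) \<and>
    (\<forall>A\<in>W. \<forall>B\<in>W. A \<odot> B \<in> W) \<and>
    (\<forall>A\<in>W. conj_transpose A \<in> W) \<and>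
    mat 1 \<in> W \<and> all_ones \<in> W"

definition cellular_closure :: "'a::finite cmatrix set \<Rightarrow> 'a cmatrix set"
  where "cellular_closure S = cellular_algebra hull S"

lemma cellular_algebra_Inter:
  assumes "\<And>W. W \<in> F \<Longrightarrow> cellular_algebra W"
  shows "cellular_algebra (\<Inter>F)"
  using assms unfolding cellular_algebra_def cmat.subspace_def by blast

lemma cellular_algebra_cellular_closure: "cellular_algebra (cellular_closure S)"
  unfolding cellular_closure_def by (rule hull_in) (simp add: cellular_algebra_Inter)

text \<open>Weak isomorphisms are total functions on matrices of which only the values on \<open>W\<close> matter.\<close>

definition weak_isomorphism ::
    "'a::finite cmatrix set \<Rightarrow> 'b::finite cmatrix set \<Rightarrow> ('a cmatrix \<Rightarrow> 'b cmatrix) \<Rightarrow> bool"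
  where "weak_isomorphism W W' \<phi> \<longleftrightarrow>
    bij_betw \<phi> W W' \<and>
    (\<forall>A\<in>W. \<forall>B\<in>W. \<phi> (A + B) = \<phi> A + \<phi> B) \<and>
    (\<forall>c. \<forall>A\<in>W. \<phi> (c *\<^sub>c A) = c *\<^sub>c \<phi> A) \<and>
    (\<forall>A\<in>W. \<forall>B\<in>W. \<phi> (A ** B) = \<phi> A ** \<phi> B) \<and>
    (\<forall>A\<in>W. \<forall>B\<in>W. \<phi> (A \<odot> B) = \<phi> A \<odot> \<phi> B) \<and>
    (\<forall>A\<in>W. \<phi> (conj_transpose A) = conj_transpose (\<phi> A))"


section \<open>Tensor powers and extensions\<close>

text \<open>
  A positive integer \<open>k\<close> is represented by a finite type \<open>'k\<close> of tensor positions with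
  \<open>CARD('k) = k\<close>, and \<open>V\<^sup>k\<close> by the finite type \<open>'k \<Rightarrow> 'v\<close>.
\<close>

definition tensor :: "('k::finite \<Rightarrow> 'v::finite cmatrix) \<Rightarrow> ('k \<Rightarrow> 'v) cmatrix"
  where "tensor A = (\<chi> x y. \<Prod>i\<in>UNIV. A i $ x i $ y i)"

definition tensor_power :: "'v::finite cmatrix set \<Rightarrow> ('k::finite \<Rightarrow> 'v) cmatrix set"
  where "tensor_power W = cmat.span {tensor A | A. \<forall>i. A i \<in> W}"

text \<open>
  \<open>is_tensor_power_map \<phi> W \<psi>\<close> says that \<open>\<psi>\<close> agrees on the tensor power of \<open>W\<close> with the
  tensor power of the map \<open>\<phi>\<close>, that is, with the linear map that sends each elementary tensor
  of matrices \<open>A i \<in> W\<close> to the elementary tensor of the matrices \<open>\<phi> (A i)\<close>.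
\<close>

definition is_tensor_power_map ::
    "('v::finite cmatrix \<Rightarrow> 'w::finite cmatrix) \<Rightarrow> 'v cmatrix set \<Rightarrow>
     (('k::finite \<Rightarrow> 'v) cmatrix \<Rightarrow> ('k \<Rightarrow> 'w) cmatrix) \<Rightarrow> bool"
  where "is_tensor_power_map \<phi> W \<psi> \<longleftrightarrow>
    (\<forall>M\<in>tensor_power W. \<forall>N\<in>tensor_power W. \<psi> (M + N) = \<psi> M + \<psi> N) \<and>
    (\<forall>c. \<forall>M\<in>tensor_power W. \<psi> (c *\<^sub>c M) = c *\<^sub>c \<psi> M) \<and>
    (\<forall>A. (\<forall>i. A i \<in> W) \<longrightarrow> \<psi> (tensor A) = tensor (\<lambda>i. \<phi> (A i)))"

lemma is_tensor_power_map_unique: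
  assumes "is_tensor_power_map \<phi> W \<psi>" "is_tensor_power_map \<phi> W \<psi>'" "M \<in> tensor_power W"
  shows "\<psi> M = \<psi>' M"
proof -
  have zero: "0 \<in> tensor_power W"
    unfolding tensor_power_def by (rule cmat.span_zero)
  have add: "M + N \<in> tensor_power W" if "M \<in> tensor_power W" "N \<in> tensor_power W" for M N
    using that unfolding tensor_power_def by (rule cmat.span_add)
  have scale: "c *\<^sub>c M \<in> tensor_power W" if "M \<in> tensor_power W" for c M
    using that unfolding tensor_power_def by (rule cmat.span_scale)
  have "\<psi> (0 *\<^sub>c 0) = 0 *\<^sub>c \<psi> 0" "\<psi>' (0 *\<^sub>c 0) = 0 *\<^sub>c \<psi>' 0"
    using assms(1,2) zero unfolding is_tensor_power_map_def by blast+
  then have "\<psi> 0 = 0" "\<psi>' 0 = 0"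
    by simp_all
  then have "cmat.subspace {M. M \<in> tensor_power W \<and> \<psi> M = \<psi>' M}"
    using assms(1,2) zero add scale
    unfolding is_tensor_power_map_def cmat.subspace_def by auto
  moreover have "{tensor A | A. \<forall>i. A i \<in> W} \<subseteq> {M. M \<in> tensor_power W \<and> \<psi> M = \<psi>' M}"
    using assms(1,2) unfolding is_tensor_power_map_def tensor_power_def
    by (auto intro: cmat.span_base)
  ultimately have "tensor_power W \<subseteq> {M. M \<in> tensor_power W \<and> \<psi> M = \<psi>' M}"
    unfolding tensor_power_def by (intro cmat.span_minimal)
  then show ?thesis
    using assms(3) by blast
qed

definition permute_matrix :: "('s \<Rightarrow> 's) \<Rightarrow> 's::finite cmatrix \<Rightarrow> 's cmatrix"
  where "permute_matrix p A = (\<chi> s t. A $ p s $ p t)"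

text \<open>
  The group is given by its underlying set \<open>\<Gamma>\<close> and its action by \<open>act\<close>. Since \<open>\<Gamma>\<close> is closed
  under inverses, it does not matter whether a matrix is permuted by an element or its inverse.
\<close>

definition invariant_matrices :: "('g \<Rightarrow> 's \<Rightarrow> 's) \<Rightarrow> 'g set \<Rightarrow> 's::finite cmatrix set"
  where "invariant_matrices act \<Gamma> = {A. \<forall>g\<in>\<Gamma>. permute_matrix (act g) A = A}"

definition sym_invariants :: "('k::finite \<Rightarrow> 'v::finite) cmatrix set"
  where "sym_invariants = invariant_matrices (\<lambda>g x. g \<circ> x) {g :: 'v \<Rightarrow> 'v. g permutes UNIV}"

definition extension :: "'v::finite cmatrix set \<Rightarrow> ('k::finite \<Rightarrow> 'v) cmatrix set"
  where "extension W = cellular_closure (tensor_power W \<union> sym_invariants)"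


section \<open>Graphs and their equivalence\<close>

definition simple_graph :: "'v::finite rel \<Rightarrow> bool"
  where "simple_graph E \<longleftrightarrow> sym E \<and> irrefl E"

definition adjacency :: "'v::finite rel \<Rightarrow> 'v cmatrix"
  where "adjacency E = (\<chi> u v. if (u, v) \<in> E then 1 else 0)"

definition graph_algebra :: "'v::finite rel \<Rightarrow> 'v cmatrix set"
  where "graph_algebra E = cellular_closure {adjacency E}"

definition graph_equivalence ::
    "'v::finite rel \<Rightarrow> 'v rel \<Rightarrow> ('v cmatrix \<Rightarrow> 'v cmatrix) \<Rightarrow> bool"
  where "graph_equivalence E E' \<phi> \<longleftrightarrow>
    weak_isomorphism (graph_algebra E) (graph_algebra E') \<phi> \<and>
    \<phi> (adjacency E) = adjacency E'"

definition k_equivalence ::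
    "'k::finite itself \<Rightarrow> 'v::finite rel \<Rightarrow> 'v rel \<Rightarrow> ('v cmatrix \<Rightarrow> 'v cmatrix) \<Rightarrow> bool"
  where "k_equivalence _ E E' \<phi> \<longleftrightarrow>
    graph_equivalence E E' \<phi> \<and>
    (\<exists>\<psi> :: ('k \<Rightarrow> 'v) cmatrix \<Rightarrow> ('k \<Rightarrow> 'v) cmatrix.
      weak_isomorphism (extension (graph_algebra E)) (extension (graph_algebra E')) \<psi> \<and>
      is_tensor_power_map \<phi> (graph_algebra E) \<psi> \<and>
      (\<forall>M\<in>sym_invariants. \<psi> M = M))"

definition k_equivalent :: "'k::finite itself \<Rightarrow> 'v::finite rel \<Rightarrow> 'v rel \<Rightarrow> bool"
  where "k_equivalent K E E' \<longleftrightarrow> (\<exists>\<phi>. k_equivalence K E E' \<phi>)"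


section \<open>The \<open>k\<close>-Boson quantum walk\<close>

text \<open>The matrix entry of \<open>M\<close> in row \<open>y\<close> and column \<open>x\<close> is \<open>\<langle>y|M|x\<rangle>\<close>.\<close>

definition basis_projection :: "'a \<Rightarrow> 'a::finite cmatrix"
  where "basis_projection x = (\<chi> i j. if i = x \<and> j = x then 1 else 0)"

text \<open>The operator of \<open>p\<close> sends the basis vector \<open>|x\<rangle>\<close> to \<open>|x \<circ> inv p\<rangle>\<close>.\<close>

definition factor_permutation :: "('k \<Rightarrow> 'k) \<Rightarrow> ('k::finite \<Rightarrow> 'v::finite) cmatrix"
  where "factor_permutation p = (\<chi> y x. if y = x \<circ> inv p then 1 else 0)"

definition kron_sum :: "'v::finite cmatrix \<Rightarrow> ('k::finite \<Rightarrow> 'v) cmatrix"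
  where "kron_sum A = (\<Sum>i\<in>UNIV. tensor (\<lambda>j. if j = i then A else mat 1))"

definition occupation :: "('k::finite \<Rightarrow> 'v::finite) \<Rightarrow> nat multiset"
  where "occupation x = image_mset (\<lambda>v. card {i. x i = v}) (mset_set UNIV)"

definition occupation_classes :: "('k::finite \<Rightarrow> 'v::finite) set set"
  where "occupation_classes = UNIV // {(x, y). occupation x = occupation y}"

definition boson_hamiltonian ::
    "(('k::finite \<Rightarrow> 'v::finite) set \<Rightarrow> real) \<Rightarrow> 'v rel \<Rightarrow> ('k \<Rightarrow> 'v) cmatrix"
  where "boson_hamiltonian U E =
    (- 1 / fact CARD('k)) *\<^sub>c
      ((\<Sum>p | p permutes UNIV. factor_permutation p) ** kron_sum (adjacency E))
    + (\<Sum>X\<in>occupation_classes. complex_of_real (U X) *\<^sub>c (\<Sum>x\<in>X. basis_projection x))"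

definition matrix_exp :: "'a::finite cmatrix \<Rightarrow> 'a cmatrix"
  where "matrix_exp M = (\<Sum>n. (1 / fact n) *\<^sub>c (((**) M ^^ n) (mat 1)))"

lemma matrix_exp_sums: "(\<lambda>n. (1 / fact n) *\<^sub>c (((**) M ^^ n) (mat 1))) sums matrix_exp M"
proof -
  define K where "K = (\<Sum>i\<in>UNIV. \<Sum>l\<in>UNIV. norm (M $ i $ l))"
  have row: "(\<Sum>l\<in>UNIV. norm (M $ i $ l)) \<le> K" for i
    unfolding K_def by (rule member_le_sum) (auto intro: sum_nonneg)
  have K0: "K \<ge> 0"
    unfolding K_def by (intro sum_nonneg) auto
  have bound: "norm ((((**) M ^^ n) (mat 1)) $ i $ j) \<le> K ^ n" for n i j
  proof (induction n arbitrary: i)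
    case 0
    show ?case by (simp add: mat_def)
  next
    case (Suc n)
    have "norm ((((**) M ^^ Suc n) (mat 1)) $ i $ j)
        \<le> (\<Sum>l\<in>UNIV. norm (M $ i $ l) * norm ((((**) M ^^ n) (mat 1)) $ l $ j))"
      by (simp add: matrix_matrix_mult_def sum_norm_le norm_mult)
    also have "\<dots> \<le> (\<Sum>l\<in>UNIV. norm (M $ i $ l) * K ^ n)"
      by (intro sum_mono mult_left_mono Suc) simp
    also have "\<dots> = (\<Sum>l\<in>UNIV. norm (M $ i $ l)) * K ^ n"
      by (simp add: sum_distrib_right)
    also have "\<dots> \<le> K * K ^ n"
      by (intro mult_right_mono row) (simp add: K0)
    finally show ?case by simp
  qed
  let ?f = "\<lambda>n. (1 / fact n) *\<^sub>c (((**) M ^^ n) (mat 1))"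
  have "summable (\<lambda>n. ?f n $ i $ j)" for i j
  proof (rule summable_comparison_test')
    show "summable (\<lambda>n. inverse (fact n) * K ^ n)"
      by (rule summable_exp)
    show "norm (?f n $ i $ j) \<le> inverse (fact n) * K ^ n" if "n \<ge> 0" for n
      using bound[of n i j]
      by (simp add: cscale_def norm_mult norm_divide divide_simps)
  qed
  then have "(\<lambda>n. ?f n $ i $ j) sums (\<Sum>n. ?f n $ i $ j)" for i j
    by (rule summable_sums)
  then have "?f sums (\<chi> i j. \<Sum>n. ?f n $ i $ j)"
    unfolding sums_def by (intro vec_tendstoI) simp
  then show ?thesis
    unfolding matrix_exp_def by (simp add: sums_iff)
qed

definition greens_functions :: "'a::finite cmatrix \<Rightarrow> real \<Rightarrow> complex set"
  where "greens_functions H t = {matrix_exp ((- \<i> * complex_of_real t) *\<^sub>c H) $ y $ x | x y. True}"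

end

theory Submission
  imports Defs
begin

text \<open>
  The Hamiltonian of \<open>E\<close> is built from the identity, the adjacency matrix and matrices that
  commute with the action of \<open>Sym V\<close>, so it lies in the extension of the graph algebra, and the weak
  isomorphism \<open>\<psi>\<close> of a \<open>k\<close>-equivalence carries it to the Hamiltonian of \<open>E'\<close>
  (\<open>boson_hamiltonian_transport\<close>). Being an algebra map, \<open>\<psi>\<close> also carries each partial sum of the
  exponential series of one Hamiltonian to that of the other.

  The second ingredient is that Hadamard multiplication sees the set of entries of a matrix: this
  set is contained in a finite set \<open>S\<close> iff the Hadamard product of the matrices \<open>M - c J\<close>,
  \<open>c \<in> S\<close>, vanishes. Hence weak isomorphisms preserve the set of entries
  (\<open>weak_isomorphism_entries\<close>), and the partial sums have equal sets of entries.
  This equality survives in the limit (\<open>entries_limit_eq\<close>), because a number is an entry of a matrix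
  iff a certain product, continuous in both, is zero. Passing to the limit on entries rather than on
  matrices avoids having to show that \<open>\<psi>\<close> is continuous and that its domain is closed.
\<close>

section \<open>Linearity of weak isomorphisms\<close>

lemma cellular_algebraD:
  assumes "cellular_algebra W"
  shows "0 \<in> W" "mat 1 \<in> W" "all_ones \<in> W"
    and "A \<in> W \<Longrightarrow> B \<in> W \<Longrightarrow> A + B \<in> W"
    and "A \<in> W \<Longrightarrow> c *\<^sub>c A \<in> W"
    and "A \<in> W \<Longrightarrow> B \<in> W \<Longrightarrow> A ** B \<in> W"
    and "A \<in> W \<Longrightarrow> B \<in> W \<Longrightarrow> A \<odot> B \<in> W"
  using assms unfolding cellular_algebra_def cmat.subspace_def by blast+

lemma weak_isomorphismD:
  assumes "weak_isomorphism W W' \<phi>"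
  shows "A \<in> W \<Longrightarrow> B \<in> W \<Longrightarrow> \<phi> (A + B) = \<phi> A + \<phi> B"
    and "A \<in> W \<Longrightarrow> \<phi> (c *\<^sub>c A) = c *\<^sub>c \<phi> A"
    and "A \<in> W \<Longrightarrow> B \<in> W \<Longrightarrow> \<phi> (A ** B) = \<phi> A ** \<phi> B"
    and "A \<in> W \<Longrightarrow> B \<in> W \<Longrightarrow> \<phi> (A \<odot> B) = \<phi> A \<odot> \<phi> B"
  using assms unfolding weak_isomorphism_def by blast+

lemma weak_isomorphism_zero:
  assumes "cellular_algebra W" "weak_isomorphism W W' \<phi>"
  shows "\<phi> 0 = 0"
  using weak_isomorphismD(2)[OF assms(2) cellular_algebraD(1)[OF assms(1)], of 0] by simp

lemma weak_isomorphism_sum: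
  assumes "cellular_algebra W" "weak_isomorphism W W' \<phi>" "\<And>i. i \<in> I \<Longrightarrow> f i \<in> W"
  shows "(\<Sum>i\<in>I. f i) \<in> W \<and> \<phi> (\<Sum>i\<in>I. f i) = (\<Sum>i\<in>I. \<phi> (f i))"
  using assms(3)
  by (induction I rule: infinite_finite_induct)
    (auto simp: cellular_algebraD[OF assms(1)] weak_isomorphismD[OF assms(2)]
      weak_isomorphism_zero[OF assms(1,2)])

lemma weak_isomorphism_mat_1:
  assumes "cellular_algebra W" "cellular_algebra W'" "weak_isomorphism W W' \<phi>"
  shows "\<phi> (mat 1) = mat 1"
proof -
  obtain A where A: "A \<in> W" "\<phi> A = mat 1"
    using assms(3) cellular_algebraD(2)[OF assms(2)]
    unfolding weak_isomorphism_def bij_betw_def by force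
  have "\<phi> (mat 1 ** A) = \<phi> (mat 1) ** \<phi> A"
    using A cellular_algebraD(2)[OF assms(1)] weak_isomorphismD(3)[OF assms(3)] by blast
  with A show ?thesis by simp
qed

lemma weak_isomorphism_all_ones:
  assumes "cellular_algebra W" "cellular_algebra W'" "weak_isomorphism W W' \<phi>"
  shows "\<phi> all_ones = all_ones"
proof -
  have unit: "all_ones \<odot> A = A" "A \<odot> all_ones = A" for A :: "'c::finite cmatrix"
    by (simp_all add: hadamard_def all_ones_def vec_eq_iff)
  obtain A where A: "A \<in> W" "\<phi> A = all_ones"
    using assms(3) cellular_algebraD(3)[OF assms(2)]
    unfolding weak_isomorphism_def bij_betw_def by force
  have "\<phi> (all_ones \<odot> A) = \<phi> all_ones \<odot> \<phi> A"
    using A cellular_algebraD(3)[OF assms(1)] weak_isomorphismD(4)[OF assms(3)] by blast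
  with A show ?thesis by (simp add: unit)
qed


section \<open>The set of entries of a matrix\<close>

definition entries :: "'a::finite cmatrix \<Rightarrow> complex set"
  where "entries M = {M $ y $ x | y x. True}"

lemma finite_entries: "finite (entries M)"
proof -
  have "entries M = (\<lambda>(y, x). M $ y $ x) ` UNIV"
    by (auto simp: entries_def)
  then show ?thesis by simp
qed

text \<open>The Hadamard product of the matrices \<open>M - c J\<close> over \<open>c \<in> S\<close>.\<close>

definition entry_annihilator :: "complex set \<Rightarrow> 'a::finite cmatrix \<Rightarrow> 'a cmatrix"
  where "entry_annihilator S M = (\<chi> i j. \<Prod>c\<in>S. (M $ i $ j - c))"

lemma entry_annihilator_eq_0_iff:
  assumes "finite S"
  shows "entry_annihilator S M = 0 \<longleftrightarrow> entries M \<subseteq> S"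
  using assms by (auto simp: entry_annihilator_def entries_def vec_eq_iff)

lemma entry_annihilator_empty: "entry_annihilator {} M = all_ones"
  by (simp add: entry_annihilator_def all_ones_def)

lemma entry_annihilator_insert:
  assumes "finite S" "c \<notin> S"
  shows "entry_annihilator (insert c S) M = (M + (- c) *\<^sub>c all_ones) \<odot> entry_annihilator S M"
  using assms
  by (simp add: entry_annihilator_def hadamard_def cscale_def all_ones_def vec_eq_iff)

lemma weak_isomorphism_entry_annihilator:
  assumes W: "cellular_algebra W" "cellular_algebra W'" "weak_isomorphism W W' \<phi>"
    and "M \<in> W" "finite S"
  shows "entry_annihilator S M \<in> W \<and> \<phi> (entry_annihilator S M) = entry_annihilator S (\<phi> M)"
  using \<open>finite S\<close>
proof (induction S)
  case empty
  show ?case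
    by (simp add: entry_annihilator_empty cellular_algebraD(3)[OF W(1)]
        weak_isomorphism_all_ones[OF W])
next
  case (insert c S)
  then show ?case
    using \<open>M \<in> W\<close>
    by (simp add: entry_annihilator_insert cellular_algebraD[OF W(1)] weak_isomorphismD[OF W(3)]
        weak_isomorphism_all_ones[OF W] del: cmat.scale_minus_left)
qed

text \<open>
  The annihilator of the entries of \<open>M\<close> is zero, so its image annihilates the entries of \<open>\<phi> M\<close>;
  injectivity of \<open>\<phi>\<close> gives the reverse inclusion.
\<close>

lemma weak_isomorphism_entries:
  assumes W: "cellular_algebra W" "cellular_algebra W'" "weak_isomorphism W W' \<phi>" and "M \<in> W"
  shows "entries (\<phi> M) = entries M"
proof
  note ann = weak_isomorphism_entry_annihilator[OF W \<open>M \<in> W\<close> finite_entries]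
  note zero = weak_isomorphism_zero[OF W(1,3)]
  have "entry_annihilator (entries M) M = 0"
    by (simp add: entry_annihilator_eq_0_iff finite_entries)
  then have "entry_annihilator (entries M) (\<phi> M) = 0"
    using ann[of M] zero by simp
  then show "entries (\<phi> M) \<subseteq> entries M"
    by (simp add: entry_annihilator_eq_0_iff finite_entries)
  have "entry_annihilator (entries (\<phi> M)) (\<phi> M) = 0"
    by (simp add: entry_annihilator_eq_0_iff finite_entries)
  then have "\<phi> (entry_annihilator (entries (\<phi> M)) M) = \<phi> 0"
    using ann[of "\<phi> M"] zero by simp
  then have "entry_annihilator (entries (\<phi> M)) M = 0"
    using ann[of "\<phi> M"] W(3) cellular_algebraD(1)[OF W(1)]
    unfolding weak_isomorphism_def bij_betw_def inj_on_def by blast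
  then show "entries M \<subseteq> entries (\<phi> M)"
    by (simp add: entry_annihilator_eq_0_iff finite_entries)
qed

lemma entries_limit_subset:
  fixes A :: "nat \<Rightarrow> 'a::finite cmatrix" and B :: "nat \<Rightarrow> 'b::finite cmatrix"
  assumes "A \<longlonglongrightarrow> A0" "B \<longlonglongrightarrow> B0" and sub: "\<And>n. entries (A n) \<subseteq> entries (B n)"
  shows "entries A0 \<subseteq> entries B0"
proof
  fix c assume "c \<in> entries A0"
  then obtain y x where c: "c = A0 $ y $ x"
    by (auto simp: entries_def)
  \<comment> \<open>The position in \<open>B n\<close> of the entry \<open>A n $ y $ x\<close> may vary with \<open>n\<close>, so the product
    ranges over all positions.\<close>
  define P where "P n = (\<Prod>(i, j)\<in>UNIV. B n $ i $ j - A n $ y $ x)" for n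
  have "P = (\<lambda>_. 0)"
  proof
    fix n
    have "A n $ y $ x \<in> entries (B n)"
      using sub[of n] unfolding entries_def by blast
    then obtain i j where "A n $ y $ x = B n $ i $ j"
      by (auto simp: entries_def)
    then show "P n = 0"
      unfolding P_def by (intro prod_zero) (auto intro!: bexI[of _ "(i, j)"])
  qed
  moreover have "P \<longlonglongrightarrow> (\<Prod>(i, j)\<in>UNIV. B0 $ i $ j - A0 $ y $ x)"
    unfolding P_def case_prod_beta
    by (intro tendsto_prod tendsto_diff tendsto_vec_nth assms(1,2))
  ultimately have "(\<Prod>(i, j)\<in>UNIV. B0 $ i $ j - A0 $ y $ x) = 0"
    by (simp add: LIMSEQ_const_iff)
  then obtain i j where "B0 $ i $ j = A0 $ y $ x"
    by (auto simp: prod_zero_iff)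
  then show "c \<in> entries B0"
    by (auto simp: c entries_def intro: sym)
qed

lemma entries_limit_eq:
  fixes A :: "nat \<Rightarrow> 'a::finite cmatrix" and B :: "nat \<Rightarrow> 'b::finite cmatrix"
  assumes "A \<longlonglongrightarrow> A0" "B \<longlonglongrightarrow> B0" "\<And>n. entries (A n) = entries (B n)"
  shows "entries A0 = entries B0"
  using entries_limit_subset[OF assms(1,2)] entries_limit_subset[OF assms(2,1)] assms(3) by blast

lemma greens_functions_eq_entries:
  "greens_functions H t = entries (matrix_exp ((- \<i> * complex_of_real t) *\<^sub>c H))"
  by (auto simp: greens_functions_def entries_def)

lemma weak_isomorphism_entries_matrix_exp:
  assumes W: "cellular_algebra W" "cellular_algebra W'" "weak_isomorphism W W' \<phi>" and M: "M \<in> W"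
  shows "entries (matrix_exp (\<phi> M)) = entries (matrix_exp M)"
proof -
  let ?term = "\<lambda>N n. (1 / fact n) *\<^sub>c (((**) N ^^ n) (mat 1))"
  have power: "((**) M ^^ n) (mat 1) \<in> W \<and>
      \<phi> (((**) M ^^ n) (mat 1)) = ((**) (\<phi> M) ^^ n) (mat 1)" for n
    by (induction n) (auto simp: M cellular_algebraD[OF W(1)] weak_isomorphismD[OF W(3)]
        weak_isomorphism_mat_1[OF W])
  have terms: "?term M n \<in> W" "\<phi> (?term M n) = ?term (\<phi> M) n" for n
    using power[of n] by (auto simp: cellular_algebraD[OF W(1)] weak_isomorphismD[OF W(3)])
  have partial_sum: "(\<Sum>n<m. ?term M n) \<in> W"
      "\<phi> (\<Sum>n<m. ?term M n) = (\<Sum>n<m. ?term (\<phi> M) n)" for m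
    using weak_isomorphism_sum[OF W(1,3), of "{..<m}" "?term M"] terms by auto
  have "entries (\<Sum>n<m. ?term (\<phi> M) n) = entries (\<Sum>n<m. ?term M n)" for m
    using weak_isomorphism_entries[OF W partial_sum(1)[of m]] partial_sum(2)[of m] by metis
  then show ?thesis
    by (rule entries_limit_eq[OF matrix_exp_sums[unfolded sums_def]
          matrix_exp_sums[unfolded sums_def]])
qed


section \<open>Transport of the Hamiltonian\<close>

lemma factor_permutation_in_sym_invariants: "factor_permutation p \<in> sym_invariants"
proof -
  have "g \<circ> s = g \<circ> t \<circ> inv p \<longleftrightarrow> s = t \<circ> inv p"
    if "g permutes UNIV" for g :: "'b \<Rightarrow> 'b" and s t :: "'a \<Rightarrow> 'b"
    using permutes_inj[OF that] by (auto simp: fun_eq_iff inj_eq)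
  then show ?thesis
    by (simp add: sym_invariants_def invariant_matrices_def permute_matrix_def
        factor_permutation_def vec_eq_iff)
qed

text \<open>Relabelling the vertices only permutes the family of occupation numbers.\<close>

lemma occupation_comp:
  fixes x :: "'k::finite \<Rightarrow> 'v::finite"
  assumes "g permutes UNIV"
  shows "occupation (g \<circ> x) = occupation x"
proof -
  have "g (x i) = v \<longleftrightarrow> x i = inv g v" for i v
    using assms by (metis permutes_inverses(1,2))
  then have "occupation (g \<circ> x)
      = image_mset (\<lambda>v. card {i. x i = v}) (image_mset (inv g) (mset_set UNIV))"
    by (simp add: occupation_def multiset.map_comp comp_def)
  also have "image_mset (inv g) (mset_set UNIV) = mset_set (UNIV :: 'v set)"
    using permutes_inv[OF assms] by (simp add: image_mset_mset_set permutes_inj permutes_surj)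
  finally show ?thesis
    by (simp add: occupation_def)
qed

lemma class_projection_in_sym_invariants:
  fixes X :: "('k::finite \<Rightarrow> 'v::finite) set"
  assumes "X \<in> occupation_classes"
  shows "(\<Sum>x\<in>X. basis_projection x) \<in> sym_invariants"
proof -
  obtain x0 :: "'k \<Rightarrow> 'v" where X: "X = {x. occupation x0 = occupation x}"
    using assms by (auto simp: occupation_classes_def quotient_def)
  have "(\<Sum>x\<in>X. basis_projection x) $ s $ t = (if s = t \<and> s \<in> X then 1 else 0)" for s t
  proof -
    have "(\<Sum>x\<in>X. basis_projection x) $ s $ t
        = (\<Sum>x\<in>X. if s = x then if s = t then 1 else 0 else 0)"
      by (cases "s = t") (auto simp: basis_projection_def intro!: sum.neutral sum.cong)
    then show ?thesis by auto
  qed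
  then have diagonal: "(\<Sum>x\<in>X. basis_projection x) = (\<chi> s t. if s = t \<and> s \<in> X then 1 else 0)"
    by (simp only: vec_eq_iff vec_lambda_beta) simp
  have "g \<circ> s = g \<circ> t \<longleftrightarrow> s = t"
    if "g permutes UNIV" for g :: "'v \<Rightarrow> 'v" and s t :: "'k \<Rightarrow> 'v"
    using permutes_inj[OF that] by (auto simp: fun_eq_iff inj_eq)
  then show ?thesis
    unfolding diagonal
    by (simp add: sym_invariants_def invariant_matrices_def permute_matrix_def vec_eq_iff
        X occupation_comp)
qed

text \<open>
  Symmetric invariants are fixed by \<open>\<psi>\<close>, and \<open>\<psi>\<close> acts on each summand of the Kronecker sum as a
  tensor power of \<open>\<phi>\<close>, which fixes the identity and sends one adjacency matrix to the other.
\<close>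

lemma boson_hamiltonian_transport:
  fixes E E' :: "'v::finite rel"
    and \<psi> :: "('k::finite \<Rightarrow> 'v) cmatrix \<Rightarrow> ('k \<Rightarrow> 'v) cmatrix"
  assumes equivalence: "graph_equivalence E E' \<phi>"
    and iso: "weak_isomorphism (extension (graph_algebra E)) (extension (graph_algebra E')) \<psi>"
    and tensor_map: "is_tensor_power_map \<phi> (graph_algebra E) \<psi>"
    and fixed: "\<forall>M\<in>sym_invariants. \<psi> M = M"
  shows "boson_hamiltonian U E \<in> extension (graph_algebra E) \<and>
    \<psi> (boson_hamiltonian U E) = boson_hamiltonian U E'"
proof -
  let ?W = "extension (graph_algebra E) :: ('k \<Rightarrow> 'v) cmatrix set"
  have W: "cellular_algebra ?W"
    by (simp add: extension_def cellular_algebra_cellular_closure)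
  have G: "cellular_algebra (graph_algebra F)" for F :: "'v rel"
    by (simp add: graph_algebra_def cellular_algebra_cellular_closure)
  have generators: "tensor_power (graph_algebra E) \<union> sym_invariants \<subseteq> ?W"
    unfolding extension_def cellular_closure_def by (rule hull_subset)
  have adj: "adjacency E \<in> graph_algebra E"
    unfolding graph_algebra_def cellular_closure_def by (rule hull_inc) simp
  have \<phi>: "\<phi> (adjacency E) = adjacency E'" "\<phi> (mat 1) = mat 1"
    using equivalence weak_isomorphism_mat_1[OF G G] by (auto simp: graph_equivalence_def)
  note sum_rule = weak_isomorphism_sum[OF W iso]
  note rules = cellular_algebraD[OF W] weak_isomorphismD[OF iso]
  define summand where "summand A i = tensor (\<lambda>j. if j = i then A else mat 1)"
    for A :: "'v cmatrix" and i :: 'k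
  have mem: "\<forall>j. (if j = i then adjacency E else mat 1) \<in> graph_algebra E" for i :: 'k
    using adj cellular_algebraD(2)[OF G] by simp
  have summand_in: "summand (adjacency E) i \<in> ?W" for i
    using mem[of i] unfolding summand_def
    by (auto intro!: subsetD[OF generators] cmat.span_base simp: tensor_power_def)
  have summand_map: "\<psi> (summand (adjacency E) i) = summand (adjacency E') i" for i
  proof -
    have "\<psi> (summand (adjacency E) i)
        = tensor (\<lambda>j. \<phi> (if j = i then adjacency E else mat 1))"
      unfolding summand_def using tensor_map[unfolded is_tensor_power_map_def] mem[of i]
      by (elim conjE allE[of _ "\<lambda>j. if j = i then adjacency E else mat 1"]) simp
    also have "(\<lambda>j. \<phi> (if j = i then adjacency E else mat 1))
        = (\<lambda>j. if j = i then adjacency E' else mat 1)"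
      by (auto simp: \<phi>)
    finally show ?thesis by (simp add: summand_def)
  qed
  have kron: "kron_sum (adjacency E) \<in> ?W"
      "\<psi> (kron_sum (adjacency E)) = kron_sum (adjacency E')"
    using sum_rule[of UNIV "summand (adjacency E)"] summand_in summand_map
    unfolding kron_sum_def summand_def by auto
  have "factor_permutation p \<in> ?W" "\<psi> (factor_permutation p) = factor_permutation p" for p
    using generators fixed factor_permutation_in_sym_invariants by blast+
  then have sym: "(\<Sum>p | p permutes UNIV. factor_permutation p) \<in> ?W"
      "\<psi> (\<Sum>p | p permutes UNIV. factor_permutation p)
        = (\<Sum>p | p permutes UNIV. factor_permutation p)"
    using sum_rule[of "{p. p permutes UNIV}" factor_permutation] by auto
  let ?R = "\<lambda>X. complex_of_real (U X) *\<^sub>c (\<Sum>x\<in>X. basis_projection x)"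
  have "?R X \<in> ?W \<and> \<psi> (?R X) = ?R X" if "X \<in> occupation_classes" for X
  proof -
    have "(\<Sum>x\<in>X. basis_projection x) \<in> ?W"
        "\<psi> (\<Sum>x\<in>X. basis_projection x) = (\<Sum>x\<in>X. basis_projection x)"
      using generators fixed class_projection_in_sym_invariants[OF that] by blast+
    then show ?thesis by (simp add: rules)
  qed
  then have penalty: "(\<Sum>X\<in>occupation_classes. ?R X) \<in> ?W"
      "\<psi> (\<Sum>X\<in>occupation_classes. ?R X) = (\<Sum>X\<in>occupation_classes. ?R X)"
    using sum_rule[of occupation_classes ?R] by auto
  show ?thesis
    unfolding boson_hamiltonian_def by (simp only: rules kron sym penalty simp_thms)
qed

theorem theorem2:
  fixes E E' :: "'v::finite rel"
  assumes "simple_graph E" and "simple_graph E'"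
    and "k_equivalent TYPE('k::finite) E E'"
  shows "\<forall>(U :: ('k \<Rightarrow> 'v) set \<Rightarrow> real) (t :: real).
    greens_functions (boson_hamiltonian U E) t = greens_functions (boson_hamiltonian U E') t"
proof (intro allI)
  fix U :: "('k \<Rightarrow> 'v) set \<Rightarrow> real" and t :: real
  obtain \<phi> and \<psi> :: "('k \<Rightarrow> 'v) cmatrix \<Rightarrow> ('k \<Rightarrow> 'v) cmatrix" where
    equivalence: "graph_equivalence E E' \<phi>"
    and iso: "weak_isomorphism (extension (graph_algebra E)) (extension (graph_algebra E')) \<psi>"
    and tensor_map: "is_tensor_power_map \<phi> (graph_algebra E) \<psi>"
    and fixed: "\<forall>M\<in>sym_invariants. \<psi> M = M"
    using assms(3) unfolding k_equivalent_def k_equivalence_def by blast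
  have W: "cellular_algebra (extension (graph_algebra F) :: ('k \<Rightarrow> 'v) cmatrix set)"
    for F :: "'v rel"
    by (simp add: extension_def cellular_algebra_cellular_closure)
  let ?c = "- \<i> * complex_of_real t"
  note H = boson_hamiltonian_transport[OF equivalence iso tensor_map fixed, of U]
  have "?c *\<^sub>c boson_hamiltonian U E \<in> extension (graph_algebra E)"
      "\<psi> (?c *\<^sub>c boson_hamiltonian U E) = ?c *\<^sub>c boson_hamiltonian U E'"
    using cellular_algebraD(5)[OF W] weak_isomorphismD(2)[OF iso] H by metis+
  then show "greens_functions (boson_hamiltonian U E) t
      = greens_functions (boson_hamiltonian U E') t"
    unfolding greens_functions_eq_entries
    using weak_isomorphism_entries_matrix_exp[OF W W iso] by metis
qed

end
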